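(* Fix a staggered mesh with periodic boundary conditions, a time step $\Delta t>0$, and constants $\kappa>0$ and $c_h\in\mathbb{R}$. For each $c_0>0$ set $\tau=\kappa/c_0^2$ and let $(T_p^n,\mathbf{J}_c^n,\boldsymbol{\psi}_p^n,\varphi_c^n)_{n\ge0}$ satisfy the dissipative scheme $$T_p^{n+1}=T_p^n-c_0\Delta t\,\nabla_p^c\cdot\mathbf{J}_c^{n+\frac12},$$ $$\mathbf{J}_c^{n+1}=\mathbf{J}_c^n-c_0\Delta t\,\nabla_c^pT_p^{n+\frac12}-c_h\Delta t\,\nabla_c^p\times\boldsymbol{\psi}_p^{n+\frac12}-\frac{\Delta t}{\tau}\mathbf{J}_c^{n+\frac12},$$ $$\boldsymbol{\psi}_p^{n+1}=\boldsymbol{\psi}_p^n+c_h\Delta t\,\nabla_p^c\times\mathbf{J}_c^{n+\frac12}-c_h\Delta t\,\nabla_p^c\varphi_c^{n+\frac12},$$ $$\varphi_c^{n+1}=\varphi_c^n-c_h\Delta t\,\nabla_c^p\cdot\boldsymbol{\psi}_p^{n+\frac12}.$$ Suppose the initial data satisfy, as $c_0\to+\infty$, $\|\mathbf{T}^0\|_{L_2}=\mathcal{O}(1)$ and $\|\nabla_p^c\cdot\mathbf{J}^0\|_{L_2}=\mathcal{O}(c_0^{-m})$ with $m\in\,]-1,+\infty]$. Then the scheme is asymptotic-preserving in the sense that the discrete Fourier law is recovered in the limit $c_0\to+\infty$, i.e. for every $n\ge0$ $$\left\|\frac{\mathbf{T}^{n+1}-\mathbf{T}^n}{\Delta t}-\kappa\,\mathbf{L}\,\mathbf{T}^{n+\frac12}\right\|_{L_2}=\mathcal{O}(c_0^{-r}),\qquad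 r=\min(2,1+m),$$ where $\mathbf{L}$ is the discrete Laplace operator $(\mathbf{L}\mathbf{T})_p=\nabla_p^c\cdot\nabla_c^pT_p$.
   Context: Staggered mesh: the domain $\Omega$ is covered by finitely many primal cells $\Omega_c$ (indexed by $c$, centers $\mathbf{x}_c$) and by dual cells $\Omega_p$ (indexed by the primal vertices $p$, centers $\mathbf{x}_p$) obtained by connecting neighboring primal cell centers; $|\Omega_c|,|\Omega_p|>0$ are their measures. Write $p\in\Omega_c$ iff $p$ is a vertex of $\Omega_c$; this is equivalent to $c\in\Omega_p$. With periodic boundary conditions the mesh is identified periodically and there are no boundary contributions. For each incident pair $(c,p)$, $l_{pc}\mathbf{n}_{pc}$ is the corner vector: the integral of the unit normal outward to $\Omega_c$ over the part of $\partial\Omega_c$ consisting of the half-edges of $\Omega_c$ adjacent to $p$ (viewed as a vector in $\mathbb{R}^3$, with vanishing third component for two-dimensional meshes), with $l_{pc}\ge0$, and $\mathbf{n}_{cp}=-\mathbf{n}_{pc}$. One has $\sum_{p\in\Omega_c}l_{pc}\mathbf{n}_{pc}=0$ and $\sum_{c\in\Omega_p}l_{pc}\mathbf{n}_{cp}=0$. Discrete operators, for $\star$ denoting multiplication by a scalar field (gradient), scalar product $\cdot$ with a vector field (divergence), or vector product $\times$ with a vector field (curl): $$(\nabla_c^p\star f_p)_c=\frac1{|\Omega_c|}\sum_{p\in\Omega_c}l_{pc}\mathbf{n}_{pc}\star f_p,\qquad(\nabla_p^c\star f_c)_p=\frac1{|\Omega_p|}\sum_{c\in\Omega_p}l_{pc}\mathbf{n}_{cp}\star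 f_c.$$ The meshes considered are such that the compatibility identities $\nabla_c^p\times\nabla_p^c\phi_c=0$, $\nabla_p^c\times\nabla_c^p\phi_p=0$, $\nabla_c^p\cdot(\nabla_p^c\times\mathbf{A}_c)=0$, $\nabla_p^c\cdot(\nabla_c^p\times\mathbf{A}_p)=0$ hold for all discrete fields (e.g. uniform Cartesian periodic meshes). Unknowns: $T_p^n\in\mathbb{R}$ and $\boldsymbol{\psi}_p^n\in\mathbb{R}^3$ live at the vertices $p$; $\mathbf{J}_c^n\in\mathbb{R}^3$ and $\varphi_c^n\in\mathbb{R}$ live at the cell centers $c$. A superscript $n+\frac12$ denotes the average of the values at $n$ and $n+1$. $\mathbf{T}^n=(T_p^n)_p$, $\mathbf{J}^n=(\mathbf{J}_c^n)_c$, and for a scalar vertex field $f$, $\|f\|_{L_2}=\sqrt{\sum_p|\Omega_p|f_p^2}$. All $\mathcal{O}$ are for $c_0\to+\infty$ with $n$, mesh, $\Delta t$, $\kappa$, $c_h$ fixed; $m=+\infty$ means $\mathcal{O}(c_0^{-k})$ for every $k$. The initial data may depend on $c_0$; $\boldsymbol{\psi}^0,\varphi^0$ are arbitrary. *)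

theory Defs
  imports "HOL-Analysis.Analysis" "HOL-Library.Landau_Symbols"
begin

(* Cells c and vertices p (equivalently, dual cells) are the elements of two finite index types.
   Periodicity is built in: a boundaryless mesh is described by its identified cells and vertices,
   and no sum below has a boundary term.  incident M p c renders both "p is a vertex of the
   primal cell c" and "c is a vertex of the dual cell p".  The corner vector of (c, p) is
   corner_len M p c *\<^sub>R corner_nrm M p c, with corner_nrm pointing out of the primal cell;
   corner_len and corner_nrm carry no information on pairs that are not incident. *)
record ('c, 'p) mesh =
  cell_vol :: "'c \<Rightarrow> real"
  dual_vol :: "'p \<Rightarrow> real"
  incident :: "'p \<Rightarrow> 'c \<Rightarrow> bool"
  corner_len :: "'p \<Rightarrow> 'c \<Rightarrow> real"
  corner_nrm :: "'p \<Rightarrow> 'c \<Rightarrow> real^3"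

definition corner_nrm_dual :: "('c, 'p) mesh \<Rightarrow> 'c \<Rightarrow> 'p \<Rightarrow> real^3" where
  "corner_nrm_dual M c p = - corner_nrm M p c"

(* The discrete operators for a generic product; the product takes the vector on the left,
   which fixes the sign of the curl. *)
definition nabla_cell ::
  "(real^3 \<Rightarrow> 'a \<Rightarrow> 'b::real_vector) \<Rightarrow> ('c, 'p::finite) mesh \<Rightarrow> ('p \<Rightarrow> 'a) \<Rightarrow> 'c \<Rightarrow> 'b" where
  "nabla_cell star M f c = (1 / cell_vol M c) *\<^sub>R
     (\<Sum>p | incident M p c. star (corner_len M p c *\<^sub>R corner_nrm M p c) (f p))"

definition nabla_dual ::
  "(real^3 \<Rightarrow> 'a \<Rightarrow> 'b::real_vector) \<Rightarrow> ('c::finite, 'p) mesh \<Rightarrow> ('c \<Rightarrow> 'a) \<Rightarrow> 'p \<Rightarrow> 'b" where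
  "nabla_dual star M f p = (1 / dual_vol M p) *\<^sub>R
     (\<Sum>c | incident M p c. star (corner_len M p c *\<^sub>R corner_nrm_dual M c p) (f c))"

definition grad_cell :: "('c, 'p::finite) mesh \<Rightarrow> ('p \<Rightarrow> real) \<Rightarrow> 'c \<Rightarrow> real^3" where
  "grad_cell = nabla_cell (\<lambda>v s. s *\<^sub>R v)"

definition div_cell :: "('c, 'p::finite) mesh \<Rightarrow> ('p \<Rightarrow> real^3) \<Rightarrow> 'c \<Rightarrow> real" where
  "div_cell = nabla_cell (\<lambda>v w. v \<bullet> w)"

definition curl_cell :: "('c, 'p::finite) mesh \<Rightarrow> ('p \<Rightarrow> real^3) \<Rightarrow> 'c \<Rightarrow> real^3" where
  "curl_cell = nabla_cell (\<lambda>v w. cross3 v w)"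

definition grad_dual :: "('c::finite, 'p) mesh \<Rightarrow> ('c \<Rightarrow> real) \<Rightarrow> 'p \<Rightarrow> real^3" where
  "grad_dual = nabla_dual (\<lambda>v s. s *\<^sub>R v)"

definition div_dual :: "('c::finite, 'p) mesh \<Rightarrow> ('c \<Rightarrow> real^3) \<Rightarrow> 'p \<Rightarrow> real" where
  "div_dual = nabla_dual (\<lambda>v w. v \<bullet> w)"

definition curl_dual :: "('c::finite, 'p) mesh \<Rightarrow> ('c \<Rightarrow> real^3) \<Rightarrow> 'p \<Rightarrow> real^3" where
  "curl_dual = nabla_dual (\<lambda>v w. cross3 v w)"

definition laplace :: "('c::finite, 'p::finite) mesh \<Rightarrow> ('p \<Rightarrow> real) \<Rightarrow> 'p \<Rightarrow> real" where
  "laplace M T = div_dual M (grad_cell M T)"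

definition compatible_mesh :: "('c::finite, 'p::finite) mesh \<Rightarrow> bool" where
  "compatible_mesh M \<longleftrightarrow>
     (\<forall>(f :: 'c \<Rightarrow> real) c. curl_cell M (grad_dual M f) c = 0) \<and>
     (\<forall>(f :: 'p \<Rightarrow> real) p. curl_dual M (grad_cell M f) p = 0) \<and>
     (\<forall>(A :: 'c \<Rightarrow> real^3) c. div_cell M (curl_dual M A) c = 0) \<and>
     (\<forall>(A :: 'p \<Rightarrow> real^3) p. div_dual M (curl_cell M A) p = 0)"

(* The geometry (cells as subsets of space, in two or three dimensions) enters only through the
   measures, the incidence relation and the corner vectors.  The two sums express that the
   primal and the dual cell boundaries are closed; for the dual cells this uses that there is no
   domain boundary. *)
definition periodic_staggered_mesh :: "('c::finite, 'p::finite) mesh \<Rightarrow> bool" where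
  "periodic_staggered_mesh M \<longleftrightarrow>
     (\<forall>c. cell_vol M c > 0) \<and> (\<forall>p. dual_vol M p > 0) \<and>
     (\<forall>p c. incident M p c \<longrightarrow> corner_len M p c \<ge> 0) \<and>
     (\<forall>c. (\<Sum>p | incident M p c. corner_len M p c *\<^sub>R corner_nrm M p c) = 0) \<and>
     (\<forall>p. (\<Sum>c | incident M p c. corner_len M p c *\<^sub>R corner_nrm_dual M c p) = 0) \<and>
     compatible_mesh M"

definition L2_norm_dual :: "('c, 'p::finite) mesh \<Rightarrow> ('p \<Rightarrow> real) \<Rightarrow> real" where
  "L2_norm_dual M f = sqrt (\<Sum>p\<in>UNIV. dual_vol M p * (f p)\<^sup>2)"

definition half :: "(nat \<Rightarrow> 'i \<Rightarrow> 'a::real_vector) \<Rightarrow> nat \<Rightarrow> 'i \<Rightarrow> 'a" where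
  "half u n i = (1 / 2) *\<^sub>R (u n i + u (Suc n) i)"

definition dissipative_scheme ::
  "('c::finite, 'p::finite) mesh \<Rightarrow> real \<Rightarrow> real \<Rightarrow> real \<Rightarrow> real \<Rightarrow>
   (nat \<Rightarrow> 'p \<Rightarrow> real) \<Rightarrow> (nat \<Rightarrow> 'c \<Rightarrow> real^3) \<Rightarrow> (nat \<Rightarrow> 'p \<Rightarrow> real^3) \<Rightarrow> (nat \<Rightarrow> 'c \<Rightarrow> real) \<Rightarrow> bool" where
  "dissipative_scheme M \<Delta>t ch \<tau> c0 T J \<psi> \<phi> \<longleftrightarrow> (\<forall>n.
     (\<forall>p. T (Suc n) p = T n p - c0 * \<Delta>t * div_dual M (half J n) p) \<and>
     (\<forall>c. J (Suc n) c = J n c - (c0 * \<Delta>t) *\<^sub>R grad_cell M (half T n) c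
            - (ch * \<Delta>t) *\<^sub>R curl_cell M (half \<psi> n) c - (\<Delta>t / \<tau>) *\<^sub>R half J n c) \<and>
     (\<forall>p. \<psi> (Suc n) p = \<psi> n p + (ch * \<Delta>t) *\<^sub>R curl_dual M (half J n) p
            - (ch * \<Delta>t) *\<^sub>R grad_dual M (half \<phi> n) p) \<and>
     (\<forall>c. \<phi> (Suc n) c = \<phi> n c - ch * \<Delta>t * div_cell M (half \<psi> n) c))"

(* f = O(c0^(-m)) as c0 tends to infinity, where m = \<infinity> means O(c0^(-k)) for every k. *)
definition decays_with_order :: "(real \<Rightarrow> real) \<Rightarrow> ereal \<Rightarrow> bool" where
  "decays_with_order f m \<longleftrightarrow>
     (if m = \<infinity> then \<forall>k::real. f \<in> O[at_top](\<lambda>c0. c0 powr (- k))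
      else f \<in> O[at_top](\<lambda>c0. c0 powr (- real_of_ereal m)))"

end

theory Submission
  imports Defs
begin

text \<open>
  Taking the discrete divergence of the equation for \<open>J\<close> removes the curl of \<open>\<psi>\<close>, so that \<open>T\<close> and
  \<open>D = div J\<close> satisfy a closed system. It shows that the residual of the Fourier law equals
  \<open>\<kappa> / (c0 \<Delta>t) (D\<^sup>n\<^sup>+\<^sup>1 - D\<^sup>n)\<close>, so it remains to bound \<open>D\<^sup>n\<close> by \<open>c0\<close> to the power \<open>- min 1 m\<close>.
  Solving for \<open>D\<^sup>n\<^sup>+\<^sup>1\<close> gives \<open>\<parallel>D\<^sup>n\<^sup>+\<^sup>1\<parallel> \<le> \<parallel>D\<^sup>n\<parallel> + O(1 / c0) \<parallel>L T\<^sup>n\<^sup>+\<^sup>1\<^sup>/\<^sup>2\<parallel>\<close>, and eliminating it from the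
  equation for \<open>T\<close> gives a Crank--Nicolson step for the heat equation with source \<open>O(1 / c0) D\<^sup>n\<close>.
  As \<open>L\<close> is negative semidefinite, \<open>\<parallel>T\<^sup>n\<^sup>+\<^sup>1\<parallel> \<le> \<parallel>T\<^sup>n\<parallel> + O(1 / c0) \<parallel>D\<^sup>n\<parallel>\<close>; both bounds then follow by
  induction on \<open>n\<close>.
\<close>

section \<open>Linearity of the dual divergence and structure of the discrete Laplacian\<close>

lemma div_dual_eq:
  "div_dual M f p = (\<Sum>c | incident M p c.
     (corner_len M p c *\<^sub>R corner_nrm_dual M c p) \<bullet> f c) / dual_vol M p"
  by (simp add: div_dual_def nabla_dual_def)

lemma div_dual_add: "div_dual M (\<lambda>c. f c + g c) p = div_dual M f p + div_dual M g p"
  unfolding div_dual_eq by (simp only: inner_add_right sum.distrib add_divide_distrib)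

lemma div_dual_scaleR: "div_dual M (\<lambda>c. a *\<^sub>R f c) p = a * div_dual M f p"
  unfolding div_dual_eq by (simp only: inner_scaleR_right sum_distrib_left[symmetric] times_divide_eq_right)

lemma div_dual_diff: "div_dual M (\<lambda>c. f c - g c) p = div_dual M f p - div_dual M g p"
  unfolding div_dual_eq by (simp only: inner_diff_right sum_subtractf diff_divide_distrib)

lemma div_dual_half: "div_dual M (half J n) p = (div_dual M (J n) p + div_dual M (J (Suc n)) p) / 2"
  unfolding half_def by (simp add: div_dual_scaleR div_dual_add)

lemma div_dual_sum:
  assumes "finite I"
  shows "div_dual M (\<lambda>c. \<Sum>i\<in>I. f i c) p = (\<Sum>i\<in>I. div_dual M (f i) p)"
  using assms
proof (induction I rule: finite_induct)
  case empty
  then show ?case by (simp add: div_dual_eq)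
next
  case (insert x F)
  then show ?case by (simp add: div_dual_add)
qed

text \<open>Expansion in the nodal basis: the values on indicator functions are the matrix entries
  of the Laplacian, from which \<open>laplace_bounded\<close> builds its constant.\<close>

lemma laplace_sum_indicator:
  fixes M :: "('c::finite, 'p::finite) mesh"
  shows "laplace M f p = (\<Sum>q\<in>UNIV. f q * laplace M (\<lambda>r. if r = q then 1 else 0) p)"
proof -
  have "grad_cell M f c = (\<Sum>q\<in>UNIV. f q *\<^sub>R grad_cell M (\<lambda>r. if r = q then 1 else 0) c)" for c
  proof -
    let ?v = "\<lambda>p. corner_len M p c *\<^sub>R corner_nrm M p c"
    have "(\<Sum>q\<in>UNIV. f q *\<^sub>R grad_cell M (\<lambda>r. if r = q then 1 else 0) c)
        = (1 / cell_vol M c) *\<^sub>R (\<Sum>q\<in>UNIV. \<Sum>p | incident M p c. (if p = q then f q else 0) *\<^sub>R ?v p)"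
      unfolding grad_cell_def nabla_cell_def scaleR_sum_right
      by (intro sum.cong refl) (auto simp: mult_ac)
    also have "\<dots> = (1 / cell_vol M c) *\<^sub>R (\<Sum>p | incident M p c. f p *\<^sub>R ?v p)"
    proof (subst sum.swap, rule arg_cong[where f = "scaleR _"], rule sum.cong[OF refl])
      fix p
      show "(\<Sum>q\<in>UNIV. (if p = q then f q else 0) *\<^sub>R ?v p) = f p *\<^sub>R ?v p"
        by (simp add: scaleR_sum_left[symmetric] del: scaleR_scaleR)
    qed
    finally show ?thesis unfolding grad_cell_def nabla_cell_def by simp
  qed
  then have "grad_cell M f = (\<lambda>c. \<Sum>q\<in>UNIV. f q *\<^sub>R grad_cell M (\<lambda>r. if r = q then 1 else 0) c)"
    by blast
  then show ?thesis
    unfolding laplace_def by (simp add: div_dual_sum div_dual_scaleR)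
qed

text \<open>The volume weights cancel the prefactors of both operators. What remains on each side is
  the same double sum over incident pairs, and the sign comes from \<open>corner_nrm_dual\<close>
  being opposite to \<open>corner_nrm\<close>.\<close>

lemma summation_by_parts:
  fixes M :: "('c::finite, 'p::finite) mesh"
  assumes "\<And>c. cell_vol M c \<noteq> 0" "\<And>p. dual_vol M p \<noteq> 0"
  shows "(\<Sum>p\<in>UNIV. dual_vol M p * (f p * div_dual M u p))
       = - (\<Sum>c\<in>UNIV. cell_vol M c * (grad_cell M f c \<bullet> u c))"
proof -
  let ?v = "\<lambda>p c. corner_len M p c *\<^sub>R corner_nrm M p c"
  have "dual_vol M p * (f p * div_dual M u p)
      = - (\<Sum>c\<in>UNIV. if incident M p c then f p * (?v p c \<bullet> u c) else 0)" for p
    using assms(2)[of p]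
    by (simp add: div_dual_eq corner_nrm_dual_def sum_negf sum.If_cases) (simp add: sum_distrib_left)
  moreover have "cell_vol M c * (grad_cell M f c \<bullet> u c)
      = (\<Sum>p\<in>UNIV. if incident M p c then f p * (?v p c \<bullet> u c) else 0)" for c
    using assms(1)[of c]
    by (simp add: grad_cell_def nabla_cell_def inner_sum_left sum.If_cases mult.assoc)
  ultimately show ?thesis
    by (simp only: sum_negf) (subst sum.swap, simp)
qed

text \<open>Summation by parts with the gradient itself as the vector field leaves minus a weighted
  sum of squares.\<close>

lemma laplace_nonpos:
  fixes M :: "('c::finite, 'p::finite) mesh"
  assumes "\<And>c. cell_vol M c > 0" "\<And>p. dual_vol M p > 0"
  shows "(\<Sum>p\<in>UNIV. dual_vol M p * (f p * laplace M f p)) \<le> 0"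
proof -
  have "(\<Sum>p\<in>UNIV. dual_vol M p * (f p * laplace M f p))
      = - (\<Sum>c\<in>UNIV. cell_vol M c * (grad_cell M f c \<bullet> grad_cell M f c))"
    unfolding laplace_def using assms by (intro summation_by_parts) (auto simp: less_imp_neq[symmetric])
  also have "\<dots> \<le> 0"
    using assms(1) by (simp add: sum_nonneg less_imp_le)
  finally show ?thesis .
qed

section \<open>The volume-weighted norm of vertex fields\<close>

context
  fixes M :: "('c, 'p::finite) mesh"
  assumes dual_vol_pos: "\<And>p. dual_vol M p > 0"
begin

text \<open>Absorbing the square root of the weight into the field gives a Euclidean norm, so the
  triangle and Cauchy-Schwarz inequalities can be taken from \<open>L2_set\<close>.\<close>

lemma L2_norm_dual_eq_L2_set: "L2_norm_dual M f = L2_set (\<lambda>p. sqrt (dual_vol M p) * f p) UNIV"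
  using dual_vol_pos by (simp add: L2_norm_dual_def L2_set_def power_mult_distrib less_imp_le)

lemma L2_norm_dual_nonneg: "L2_norm_dual M f \<ge> 0"
  by (simp add: L2_norm_dual_eq_L2_set)

lemma L2_norm_dual_power2: "(L2_norm_dual M f)\<^sup>2 = (\<Sum>p\<in>UNIV. dual_vol M p * (f p)\<^sup>2)"
  using dual_vol_pos by (simp add: L2_norm_dual_def sum_nonneg less_imp_le)

lemma L2_norm_dual_mult: "L2_norm_dual M (\<lambda>p. a * f p) = \<bar>a\<bar> * L2_norm_dual M f"
proof -
  have "(\<Sum>p\<in>UNIV. dual_vol M p * (a * f p)\<^sup>2) = a\<^sup>2 * (\<Sum>p\<in>UNIV. dual_vol M p * (f p)\<^sup>2)"
    by (simp add: sum_distrib_left power_mult_distrib mult_ac)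
  then show ?thesis by (simp add: L2_norm_dual_def real_sqrt_mult)
qed

lemma L2_norm_dual_triangle:
  "L2_norm_dual M (\<lambda>p. f p + g p) \<le> L2_norm_dual M f + L2_norm_dual M g"
  using L2_set_triangle_ineq[of "\<lambda>p. sqrt (dual_vol M p) * f p" "\<lambda>p. sqrt (dual_vol M p) * g p" UNIV]
  by (simp add: L2_norm_dual_eq_L2_set distrib_left)

lemma L2_norm_dual_lincomb:
  "L2_norm_dual M (\<lambda>p. a * f p + b * g p) \<le> \<bar>a\<bar> * L2_norm_dual M f + \<bar>b\<bar> * L2_norm_dual M g"
  using L2_norm_dual_triangle[of "\<lambda>p. a * f p" "\<lambda>p. b * g p"] by (simp add: L2_norm_dual_mult)

lemma L2_norm_dual_sum:
  "L2_norm_dual M (\<lambda>p. \<Sum>i\<in>I. f i p) \<le> (\<Sum>i\<in>I. L2_norm_dual M (f i))"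
proof (induction I rule: infinite_finite_induct)
  case (insert x F)
  then show ?case
    using L2_norm_dual_triangle[of "f x" "\<lambda>p. \<Sum>i\<in>F. f i p"] by simp
qed (simp_all add: L2_norm_dual_def)

lemma dual_Cauchy_Schwarz:
  "(\<Sum>p\<in>UNIV. dual_vol M p * (f p * g p)) \<le> L2_norm_dual M f * L2_norm_dual M g"
proof -
  have "(\<Sum>p\<in>UNIV. dual_vol M p * (f p * g p))
      \<le> (\<Sum>p\<in>UNIV. \<bar>sqrt (dual_vol M p) * f p\<bar> * \<bar>sqrt (dual_vol M p) * g p\<bar>)"
  proof (rule sum_mono)
    fix p
    have "dual_vol M p * (f p * g p) = (sqrt (dual_vol M p) * f p) * (sqrt (dual_vol M p) * g p)"
      using dual_vol_pos[of p] by (simp add: mult_ac)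
    then show "dual_vol M p * (f p * g p)
        \<le> \<bar>sqrt (dual_vol M p) * f p\<bar> * \<bar>sqrt (dual_vol M p) * g p\<bar>"
      by (metis abs_ge_self abs_mult)
  qed
  also have "\<dots> \<le> L2_norm_dual M f * L2_norm_dual M g"
    unfolding L2_norm_dual_eq_L2_set by (rule L2_set_mult_ineq)
  finally show ?thesis .
qed

lemma abs_le_L2_norm_dual: "\<bar>f p\<bar> \<le> L2_norm_dual M f / sqrt (dual_vol M p)"
proof -
  have "\<bar>sqrt (dual_vol M p) * f p\<bar> \<le> L2_norm_dual M f"
    unfolding L2_norm_dual_eq_L2_set
    using member_le_L2_set[of UNIV p "\<lambda>p. \<bar>sqrt (dual_vol M p) * f p\<bar>"]
    by (simp add: L2_set_def)
  then show ?thesis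
    using dual_vol_pos[of p] by (simp add: abs_mult field_simps)
qed

end

section \<open>Estimates for the Laplacian and the heat equation\<close>

text \<open>A linear map on a finite-dimensional space is bounded. The point is that
  \<open>K\<close> depends on the mesh alone, hence is uniform in \<open>c0\<close> and in the time
  level.\<close>

lemma laplace_bounded:
  fixes M :: "('c::finite, 'p::finite) mesh"
  assumes "\<And>p. dual_vol M p > 0"
  obtains K where "K \<ge> 0" "\<And>f. L2_norm_dual M (laplace M f) \<le> K * L2_norm_dual M f"
proof
  let ?\<delta> = "\<lambda>q r. if r = q then 1 else 0 :: real"
  let ?K = "\<Sum>q\<in>UNIV. L2_norm_dual M (laplace M (?\<delta> q)) / sqrt (dual_vol M q)"
  show "?K \<ge> 0"
    using assms by (intro sum_nonneg divide_nonneg_nonneg L2_norm_dual_nonneg) (auto simp: less_imp_le)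
  fix f
  have "L2_norm_dual M (laplace M f) = L2_norm_dual M (\<lambda>p. \<Sum>q\<in>UNIV. f q * laplace M (?\<delta> q) p)"
    by (intro arg_cong[where f = "L2_norm_dual M"] ext laplace_sum_indicator)
  also have "\<dots> \<le> (\<Sum>q\<in>UNIV. \<bar>f q\<bar> * L2_norm_dual M (laplace M (?\<delta> q)))"
    using L2_norm_dual_sum[OF assms, of "\<lambda>q p. f q * laplace M (?\<delta> q) p" UNIV]
    by (simp add: L2_norm_dual_mult[OF assms])
  also have "\<dots> \<le> (\<Sum>q\<in>UNIV. L2_norm_dual M f / sqrt (dual_vol M q) * L2_norm_dual M (laplace M (?\<delta> q)))"
    by (intro sum_mono mult_right_mono abs_le_L2_norm_dual L2_norm_dual_nonneg assms)
  also have "\<dots> = ?K * L2_norm_dual M f"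
    by (simp add: sum_distrib_left mult_ac)
  finally show "L2_norm_dual M (laplace M f) \<le> ?K * L2_norm_dual M f" .
qed

text \<open>Energy method: the step is tested with the sum of the two time levels, that is, twice
  \<open>half T n\<close>. The diffusion term then has a sign by \<open>laplace_nonpos\<close>, and
  Cauchy-Schwarz handles the source.\<close>

lemma heat_step_stable:
  fixes M :: "('c::finite, 'p::finite) mesh"
  assumes "\<And>c. cell_vol M c > 0" "\<And>p. dual_vol M p > 0"
    and "b \<ge> 0"
    and step: "\<And>p. T (Suc n) p = T n p + g p + b * laplace M (half T n) p"
  shows "L2_norm_dual M (T (Suc n)) \<le> L2_norm_dual M (T n) + L2_norm_dual M g"
proof (rule ccontr)
  note nonneg = L2_norm_dual_nonneg[OF assms(2)]
  let ?x = "L2_norm_dual M (T n)" and ?y = "L2_norm_dual M (T (Suc n))" and ?g = "L2_norm_dual M g"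
  let ?h = "half T n"
  assume "\<not> ?y \<le> ?x + ?g"
  then have gt: "?y - ?x > ?g" by simp
  \<comment> \<open>Arguing by contradiction makes the sum of the norms strictly positive, so this
    factor can be cancelled from the energy inequality without a separate case for zero.\<close>
  with nonneg[of "T n"] nonneg[of g] have pos: "?y + ?x > 0" by linarith
  have "?y\<^sup>2 - ?x\<^sup>2 = (\<Sum>p\<in>UNIV. dual_vol M p * ((T (Suc n) p)\<^sup>2 - (T n p)\<^sup>2))"
    by (simp add: L2_norm_dual_power2[OF assms(2)] sum_subtractf right_diff_distrib)
  also have "\<dots> = (\<Sum>p\<in>UNIV. 2 * (dual_vol M p * (g p * ?h p)) +
      2 * b * (dual_vol M p * (?h p * laplace M ?h p)))"
  proof (rule sum.cong[OF refl])
    fix p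
    have "(T (Suc n) p)\<^sup>2 - (T n p)\<^sup>2 = (T (Suc n) p - T n p) * (2 * ?h p)"
      by (simp add: half_def power2_eq_square algebra_simps)
    also have "T (Suc n) p - T n p = g p + b * laplace M ?h p"
      by (simp add: step)
    finally show "dual_vol M p * ((T (Suc n) p)\<^sup>2 - (T n p)\<^sup>2) =
        2 * (dual_vol M p * (g p * ?h p)) + 2 * b * (dual_vol M p * (?h p * laplace M ?h p))"
      by (simp add: algebra_simps)
  qed
  also have "\<dots> = 2 * (\<Sum>p\<in>UNIV. dual_vol M p * (g p * ?h p)) +
      2 * b * (\<Sum>p\<in>UNIV. dual_vol M p * (?h p * laplace M ?h p))"
    by (simp only: sum.distrib sum_distrib_left)
  also have "\<dots> \<le> 2 * (?g * L2_norm_dual M ?h) + 0"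
    using dual_Cauchy_Schwarz[OF assms(2), of g ?h] laplace_nonpos[OF assms(1,2), of ?h] \<open>b \<ge> 0\<close>
    by (intro add_mono) (auto intro: mult_nonneg_nonpos)
  also have "\<dots> \<le> ?g * (?x + ?y)"
  proof -
    have "L2_norm_dual M ?h \<le> (?x + ?y) / 2"
      using L2_norm_dual_lincomb[OF assms(2), of "1/2" "T n" "1/2" "T (Suc n)"]
      by (simp add: half_def[abs_def] distrib_left add_divide_distrib)
    from mult_left_mono[OF this nonneg[of g]] show ?thesis by simp
  qed
  also have "\<dots> < (?y - ?x) * (?y + ?x)"
    using mult_strict_right_mono[OF gt pos] by (simp add: add.commute)
  also have "\<dots> = ?y\<^sup>2 - ?x\<^sup>2"
    by (simp add: power2_eq_square algebra_simps)
  finally show False by simp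
qed

section \<open>One time step of the scheme at fixed \<open>c0\<close>\<close>

context
  fixes M :: "('c::finite, 'p::finite) mesh" and \<Delta>t \<kappa> ch c0 K :: real
    and T :: "nat \<Rightarrow> 'p \<Rightarrow> real" and J :: "nat \<Rightarrow> 'c \<Rightarrow> real^3"
    and \<psi> :: "nat \<Rightarrow> 'p \<Rightarrow> real^3" and \<phi> :: "nat \<Rightarrow> 'c \<Rightarrow> real"
  assumes mesh: "periodic_staggered_mesh M"
    and pos: "\<Delta>t > 0" "\<kappa> > 0" "c0 > 0"
    and scheme: "dissipative_scheme M \<Delta>t ch (\<kappa> / c0\<^sup>2) c0 T J \<psi> \<phi>"
begin

private lemma vols: "cell_vol M c > 0" "dual_vol M p > 0"
  using mesh by (auto simp: periodic_staggered_mesh_def)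

private lemma T_step:
  "T (Suc n) p = T n p - c0 * \<Delta>t * ((div_dual M (J n) p + div_dual M (J (Suc n)) p) / 2)"
  using scheme unfolding dissipative_scheme_def div_dual_half by blast

text \<open>The divergence of the curl of \<psi> vanishes by mesh compatibility, and the divergence
  of the gradient is the Laplacian, so the equation closes in \<open>T\<close> and the divergence of
  \<open>J\<close>.\<close>

private lemma div_J_step:
  "div_dual M (J (Suc n)) p = div_dual M (J n) p - c0 * \<Delta>t * laplace M (half T n) p
     - \<Delta>t * c0\<^sup>2 / \<kappa> * ((div_dual M (J n) p + div_dual M (J (Suc n)) p) / 2)"
proof -
  have "J (Suc n) = (\<lambda>c. J n c - (c0 * \<Delta>t) *\<^sub>R grad_cell M (half T n) c
      - (ch * \<Delta>t) *\<^sub>R curl_cell M (half \<psi> n) c - (\<Delta>t / (\<kappa> / c0\<^sup>2)) *\<^sub>R half J n c)"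
    using scheme by (auto simp: dissipative_scheme_def fun_eq_iff)
  then have "div_dual M (J (Suc n)) p = div_dual M (J n) p
      - (c0 * \<Delta>t) * div_dual M (\<lambda>c. grad_cell M (half T n) c) p
      - (ch * \<Delta>t) * div_dual M (\<lambda>c. curl_cell M (half \<psi> n) c) p
      - (\<Delta>t / (\<kappa> / c0\<^sup>2)) * div_dual M (\<lambda>c. half J n c) p"
    by (simp only: div_dual_diff div_dual_scaleR)
  moreover have "div_dual M (curl_cell M (half \<psi> n)) p = 0"
    using mesh by (simp add: periodic_staggered_mesh_def compatible_mesh_def)
  ultimately show ?thesis
    by (simp add: laplace_def div_dual_half)
qed

lemma fourier_residual_bound:
  "L2_norm_dual M (\<lambda>p. (T (Suc n) p - T n p) / \<Delta>t - \<kappa> * laplace M (half T n) p)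
     \<le> \<kappa> / (c0 * \<Delta>t) * (L2_norm_dual M (div_dual M (J n)) + L2_norm_dual M (div_dual M (J (Suc n))))"
proof -
  have "(T (Suc n) p - T n p) / \<Delta>t - \<kappa> * laplace M (half T n) p
      = \<kappa> / (c0 * \<Delta>t) * div_dual M (J (Suc n)) p + (- \<kappa> / (c0 * \<Delta>t)) * div_dual M (J n) p" for p
  proof -
    define d e l where "d = div_dual M (J n) p" "e = div_dual M (J (Suc n)) p"
      "l = laplace M (half T n) p"
    have "e - d = - (c0 * \<Delta>t * l) - \<Delta>t * c0\<^sup>2 / \<kappa> * ((d + e) / 2)"
      using div_J_step[of n p] unfolding d_e_l_def by linarith
    \<comment> \<open>This scaling turns the relaxation term into
      \<open>- c0 * ((d + e) / 2)\<close>, which is exactly the difference quotient of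
      \<open>T\<close>.\<close>
    then have "\<kappa> / (c0 * \<Delta>t) * (e - d) = - c0 * ((d + e) / 2) - \<kappa> * l"
      using pos by (simp add: field_simps power2_eq_square)
    moreover have "(T (Suc n) p - T n p) / \<Delta>t = - c0 * ((d + e) / 2)"
      using T_step[of n p] pos unfolding d_e_l_def by simp
    moreover have "\<kappa> / (c0 * \<Delta>t) * e + (- \<kappa> / (c0 * \<Delta>t)) * d = \<kappa> / (c0 * \<Delta>t) * (e - d)"
      by (simp add: right_diff_distrib)
    ultimately show ?thesis
      unfolding d_e_l_def by linarith
  qed
  then have "(\<lambda>p. (T (Suc n) p - T n p) / \<Delta>t - \<kappa> * laplace M (half T n) p)
      = (\<lambda>p. \<kappa> / (c0 * \<Delta>t) * div_dual M (J (Suc n)) p + (- \<kappa> / (c0 * \<Delta>t)) * div_dual M (J n) p)"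
    by (rule ext)
  then show ?thesis
    using L2_norm_dual_lincomb[OF vols(2), of "\<kappa> / (c0 * \<Delta>t)" "div_dual M (J (Suc n))"
        "- \<kappa> / (c0 * \<Delta>t)" "div_dual M (J n)"] pos
    by (simp add: distrib_left add.commute)
qed

text \<open>Both increments carry a factor \<open>1 / c0\<close> with a constant independent of
  \<open>c0\<close>; this is what the later induction on \<open>n\<close> relies on.\<close>

lemma scheme_step_bounds:
  assumes K: "K \<ge> 0" "\<And>f. L2_norm_dual M (laplace M f) \<le> K * L2_norm_dual M f"
  shows "L2_norm_dual M (T (Suc n)) \<le>
           L2_norm_dual M (T n) + 2 * \<kappa> / c0 * L2_norm_dual M (div_dual M (J n))"
    and "L2_norm_dual M (div_dual M (J (Suc n))) \<le>
           L2_norm_dual M (div_dual M (J n)) +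
           \<kappa> * K / c0 * (L2_norm_dual M (T n) + L2_norm_dual M (T (Suc n)))"
proof -
  \<comment> \<open>Here \<open>a\<close> is \<Delta>t / (2 \<tau>), the relaxation coefficient
    halved by the time average, and \<beta> is the coefficient of the Laplacian once the implicit
    equation is solved for the new divergence.\<close>
  define a where "a = c0\<^sup>2 * \<Delta>t / (2 * \<kappa>)"
  define \<beta> where "\<beta> = c0 * \<Delta>t / (1 + a)"
  note nonneg = L2_norm_dual_nonneg[OF vols(2)]
  have a: "a > 0" using pos by (simp add: a_def)
  have \<beta>: "\<beta> > 0" using pos a by (simp add: \<beta>_def)
  \<comment> \<open>Dropping the 1 in \<open>1 + a\<close> leaves a bound of order
    \<open>1 / c0\<close>, since \<open>a\<close> grows like the square of
    \<open>c0\<close>.\<close>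
  have \<beta>_le: "\<beta> \<le> 2 * \<kappa> / c0"
  proof -
    have "\<beta> \<le> c0 * \<Delta>t / a"
      unfolding \<beta>_def using a pos by (intro divide_left_mono) auto
    also have "\<dots> = 2 * \<kappa> / c0"
      using pos by (simp add: a_def power2_eq_square)
    finally show ?thesis .
  qed
  have J_eq: "div_dual M (J (Suc n)) p =
      (1 - a) / (1 + a) * div_dual M (J n) p + (- \<beta>) * laplace M (half T n) p" for p
  proof -
    define d e l where "d = div_dual M (J n) p" "e = div_dual M (J (Suc n)) p"
      "l = laplace M (half T n) p"
    have "\<Delta>t * c0\<^sup>2 / \<kappa> * ((d + e) / 2) = a * (d + e)"
      by (simp add: a_def mult_ac)
    then have "e = d - c0 * \<Delta>t * l - a * (d + e)"
      using div_J_step[of n p] unfolding d_e_l_def by simp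
    then have "(1 + a) * e = (1 - a) * d - c0 * \<Delta>t * l"
      by (simp add: algebra_simps)
    then have "e = ((1 - a) * d - c0 * \<Delta>t * l) / (1 + a)"
      using a by (simp add: nonzero_eq_divide_eq mult.commute)
    then show ?thesis
      unfolding d_e_l_def \<beta>_def by (simp add: diff_divide_distrib[of "_ * _"])
  qed
  \<comment> \<open>Substituting \<open>J_eq\<close> into the time average yields the form required
    by \<open>heat_step_stable\<close>, with the old divergence as source.\<close>
  have T_eq: "T (Suc n) p = T n p + (- \<beta>) * div_dual M (J n) p
      + c0 * \<Delta>t * \<beta> / 2 * laplace M (half T n) p" for p
  proof -
    have "1 + (1 - a) / (1 + a) = 2 / (1 + a)"
      using a by (simp add: field_simps)
    then have avg: "(div_dual M (J n) p + div_dual M (J (Suc n)) p) / 2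
        = div_dual M (J n) p / (1 + a) - \<beta> / 2 * laplace M (half T n) p"
      unfolding J_eq using a by (simp add: field_simps)
    show ?thesis
      unfolding T_step[of n p] avg by (simp add: \<beta>_def algebra_simps)
  qed
  have "L2_norm_dual M (T (Suc n)) \<le>
      L2_norm_dual M (T n) + L2_norm_dual M (\<lambda>p. (- \<beta>) * div_dual M (J n) p)"
    using pos \<beta> by (intro heat_step_stable[OF vols _ T_eq]) simp
  also have "L2_norm_dual M (\<lambda>p. (- \<beta>) * div_dual M (J n) p) = \<beta> * L2_norm_dual M (div_dual M (J n))"
    using \<beta> by (subst L2_norm_dual_mult[OF vols(2)]) simp
  also have "\<dots> \<le> 2 * \<kappa> / c0 * L2_norm_dual M (div_dual M (J n))"
    by (intro mult_right_mono \<beta>_le nonneg)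
  finally show "L2_norm_dual M (T (Suc n)) \<le>
      L2_norm_dual M (T n) + 2 * \<kappa> / c0 * L2_norm_dual M (div_dual M (J n))"
    by simp
  have "L2_norm_dual M (div_dual M (J (Suc n))) \<le>
      \<bar>(1 - a) / (1 + a)\<bar> * L2_norm_dual M (div_dual M (J n)) +
      \<bar>- \<beta>\<bar> * L2_norm_dual M (laplace M (half T n))"
    unfolding ext[of "div_dual M (J (Suc n))", OF J_eq] by (rule L2_norm_dual_lincomb[OF vols(2)])
  also have "\<dots> \<le> 1 * L2_norm_dual M (div_dual M (J n)) +
      2 * \<kappa> / c0 * (K * ((L2_norm_dual M (T n) + L2_norm_dual M (T (Suc n))) / 2))"
  proof (intro add_mono mult_mono)
    \<comment> \<open>The amplification factor tends to -1 as \<open>c0\<close> grows: the old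
      divergence is not damped in the limit, but it is never amplified.\<close>
    show "\<bar>(1 - a) / (1 + a)\<bar> \<le> 1" using a by simp
    have "L2_norm_dual M (half T n) \<le> (L2_norm_dual M (T n) + L2_norm_dual M (T (Suc n))) / 2"
      using L2_norm_dual_lincomb[OF vols(2), of "1/2" "T n" "1/2" "T (Suc n)"]
      by (simp add: half_def[abs_def] distrib_left add_divide_distrib)
    from mult_left_mono[OF this K(1)] K(2)[of "half T n"]
    show "L2_norm_dual M (laplace M (half T n)) \<le>
        K * ((L2_norm_dual M (T n) + L2_norm_dual M (T (Suc n))) / 2)" by linarith
  qed (use \<beta> \<beta>_le pos in \<open>auto intro: nonneg\<close>)
  finally show "L2_norm_dual M (div_dual M (J (Suc n))) \<le>
      L2_norm_dual M (div_dual M (J n)) +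
      \<kappa> * K / c0 * (L2_norm_dual M (T n) + L2_norm_dual M (T (Suc n)))"
    by (simp add: mult.assoc)
qed

end

section \<open>Orders of decay at infinity\<close>

lemma powr_neg_bigo:
  assumes "s \<le> (t::real)"
  shows "(\<lambda>x::real. x powr (- t)) \<in> O[at_top](\<lambda>x. x powr (- s))"
  using assms by (intro landau_o.big_mono eventually_mono[OF eventually_ge_at_top[of 1]])
    (auto intro: powr_mono)

lemma bigo_divide_at_top:
  assumes "f \<in> O[at_top](\<lambda>x::real. x powr (- s))"
  shows "(\<lambda>x. C / x * f x) \<in> O[at_top](\<lambda>x. x powr (- (1 + s)))"
proof -
  have "(\<lambda>x::real. C / x) \<in> O[at_top](\<lambda>x. x powr (- 1))"
    \<comment> \<open>The added 1 keeps the Landau constant positive when \<open>C\<close> is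
      zero.\<close>
    by (intro landau_o.bigI[of "\<bar>C\<bar> + 1"] eventually_mono[OF eventually_gt_at_top[of 0]])
      (auto simp: powr_minus_divide field_simps)
  from landau_o.big.mult[OF this assms] show ?thesis
    by (simp only: powr_add[symmetric] minus_add_distrib)
qed

section \<open>Propagation of the orders through the time levels\<close>

theorem theorem4p1:
  fixes M :: "('c::finite, 'p::finite) mesh"
    and \<Delta>t \<kappa> ch :: real
    and m :: ereal
    and T :: "real \<Rightarrow> nat \<Rightarrow> 'p \<Rightarrow> real"
    and J :: "real \<Rightarrow> nat \<Rightarrow> 'c \<Rightarrow> real^3"
    and \<psi> :: "real \<Rightarrow> nat \<Rightarrow> 'p \<Rightarrow> real^3"
    and \<phi> :: "real \<Rightarrow> nat \<Rightarrow> 'c \<Rightarrow> real"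
  assumes "periodic_staggered_mesh M"
    and "\<Delta>t > 0" and "\<kappa> > 0"
    and "\<And>c0. c0 > 0 \<Longrightarrow>
      dissipative_scheme M \<Delta>t ch (\<kappa> / c0\<^sup>2) c0 (T c0) (J c0) (\<psi> c0) (\<phi> c0)"
    and "m > -1"
    and "(\<lambda>c0. L2_norm_dual M (T c0 0)) \<in> O[at_top](\<lambda>_. 1)"
    and "decays_with_order (\<lambda>c0. L2_norm_dual M (div_dual M (J c0 0))) m"
  shows "\<forall>n. decays_with_order
      (\<lambda>c0. L2_norm_dual M (\<lambda>p. (T c0 (Suc n) p - T c0 n p) / \<Delta>t
                                  - \<kappa> * laplace M (half (T c0) n) p))
      (min 2 (1 + m))"
proof
  fix n
  have dual_pos: "\<And>p. dual_vol M p > 0"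
    using assms(1) by (simp add: periodic_staggered_mesh_def)
  note nonneg = L2_norm_dual_nonneg[OF dual_pos]
  obtain K where K: "K \<ge> 0" "\<And>f. L2_norm_dual M (laplace M f) \<le> K * L2_norm_dual M f"
    using laplace_bounded[OF dual_pos] by blast
  let ?T = "\<lambda>n c0. L2_norm_dual M (T c0 n)" and ?D = "\<lambda>n c0. L2_norm_dual M (div_dual M (J c0 n))"
  \<comment> \<open>The real number \<open>s\<close> stands for the minimum of 1 and
    \<open>m\<close>, which is finite even for infinite \<open>m\<close>. The cap at 1 reflects the
    contribution of order \<open>1 / c0\<close> that each step adds to the divergence.\<close>
  obtain s :: real where s: "-1 < s" "s \<le> 1" "min 2 (1 + m) = ereal (1 + s)"
    and D0: "?D 0 \<in> O[at_top](\<lambda>x. x powr (- s))"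
  proof (cases m)
    case (real r)
    have "?D 0 \<in> O[at_top](\<lambda>x. x powr (- r))"
      using assms(7) real by (simp add: decays_with_order_def)
    then have "?D 0 \<in> O[at_top](\<lambda>x. x powr (- min 1 r))"
      by (rule landau_o.big_trans) (rule powr_neg_bigo, simp)
    moreover have "min 2 (1 + m) = ereal (1 + min 1 r)"
      using real by (auto simp: min_def one_ereal_def numeral_eq_ereal)
    moreover have "- 1 < min 1 r"
      using assms(5) real by (simp add: one_ereal_def)
    ultimately show ?thesis by (intro that[of "min 1 r"]) auto
  next
    case PInf
    then have "\<forall>k::real. ?D 0 \<in> O[at_top](\<lambda>x. x powr (- k))"
      using assms(7) by (simp add: decays_with_order_def)
    then have "?D 0 \<in> O[at_top](\<lambda>x. x powr (- 1))" ..
    moreover have "min 2 (1 + m) = ereal (1 + 1)"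
      using PInf by (simp add: min_def)
    ultimately show ?thesis by (intro that[of 1]) auto
  next
    case MInf
    then show ?thesis using assms(5) by simp
  qed
  \<comment> \<open>Boundedness is written as order \<open>- 0\<close> so that
    \<open>bigo_divide_at_top\<close> and \<open>powr_neg_bigo\<close> apply to it.\<close>
  have bounds: "?T n \<in> O[at_top](\<lambda>x. x powr (- 0)) \<and> ?D n \<in> O[at_top](\<lambda>x. x powr (- s))" for n
  proof (induction n)
    case 0
    have "(\<lambda>_. 1) \<in> O[at_top](\<lambda>x::real. x powr (- 0))"
      by (intro landau_o.big_mono eventually_mono[OF eventually_gt_at_top[of 0]]) auto
    then show ?case using landau_o.big_trans[OF assms(6)] D0 by blast
  next
    case (Suc n)
    \<comment> \<open>The source has order \<open>1 + s\<close>, which is nonnegative because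
      \<open>-1 < s\<close>; this is where the assumption \<open>m > -1\<close> enters.\<close>
    have "(\<lambda>c0. 2 * \<kappa> / c0 * ?D n c0) \<in> O[at_top](\<lambda>x. x powr (- 0))"
      by (rule landau_o.big_trans[OF bigo_divide_at_top powr_neg_bigo]) (use Suc s in auto)
    then have "(\<lambda>c0. ?T n c0 + 2 * \<kappa> / c0 * ?D n c0) \<in> O[at_top](\<lambda>x. x powr (- 0))"
      using Suc by (intro sum_in_bigo) auto
    moreover have "?T (Suc n) \<in> O[at_top](\<lambda>c0. ?T n c0 + 2 * \<kappa> / c0 * ?D n c0)"
    proof (intro landau_o.big_mono eventually_mono[OF eventually_gt_at_top[of 0]])
      fix c0 :: real assume "c0 > 0"
      from scheme_step_bounds(1)[OF assms(1-3) this assms(4)[OF this] K, of n]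
      show "norm (?T (Suc n) c0) \<le> norm (?T n c0 + 2 * \<kappa> / c0 * ?D n c0)"
        using nonneg[of "T c0 (Suc n)"] by simp
    qed
    ultimately have T: "?T (Suc n) \<in> O[at_top](\<lambda>x. x powr (- 0))"
      using landau_o.big_trans by blast
    then have "(\<lambda>c0. ?T n c0 + ?T (Suc n) c0) \<in> O[at_top](\<lambda>x. x powr (- 0))"
      using Suc by (intro sum_in_bigo) auto
    \<comment> \<open>The new term has order 1, and \<open>s \<le> 1\<close> lets it be absorbed
      into order \<open>s\<close>.\<close>
    from landau_o.big_trans[OF bigo_divide_at_top[OF this] powr_neg_bigo] s
    have "(\<lambda>c0. \<kappa> * K / c0 * (?T n c0 + ?T (Suc n) c0)) \<in> O[at_top](\<lambda>x. x powr (- s))"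
      by simp
    then have "(\<lambda>c0. ?D n c0 + \<kappa> * K / c0 * (?T n c0 + ?T (Suc n) c0)) \<in> O[at_top](\<lambda>x. x powr (- s))"
      using Suc by (intro sum_in_bigo) auto
    moreover have "?D (Suc n) \<in> O[at_top](\<lambda>c0. ?D n c0 + \<kappa> * K / c0 * (?T n c0 + ?T (Suc n) c0))"
    proof (intro landau_o.big_mono eventually_mono[OF eventually_gt_at_top[of 0]])
      fix c0 :: real assume "c0 > 0"
      from scheme_step_bounds(2)[OF assms(1-3) this assms(4)[OF this] K, of n]
      show "norm (?D (Suc n) c0) \<le> norm (?D n c0 + \<kappa> * K / c0 * (?T n c0 + ?T (Suc n) c0))"
        using nonneg[of "div_dual M (J c0 (Suc n))"] by simp
    qed
    ultimately show ?case using T landau_o.big_trans by blast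
  qed
  let ?R = "\<lambda>c0. L2_norm_dual M (\<lambda>p. (T c0 (Suc n) p - T c0 n p) / \<Delta>t
                                  - \<kappa> * laplace M (half (T c0) n) p)"
  have "(\<lambda>c0. ?D n c0 + ?D (Suc n) c0) \<in> O[at_top](\<lambda>x. x powr (- s))"
    using bounds by (intro sum_in_bigo) auto
  then have "(\<lambda>c0. \<kappa> / \<Delta>t / c0 * (?D n c0 + ?D (Suc n) c0)) \<in> O[at_top](\<lambda>x. x powr (- (1 + s)))"
    by (rule bigo_divide_at_top)
  moreover have "?R \<in> O[at_top](\<lambda>c0. \<kappa> / \<Delta>t / c0 * (?D n c0 + ?D (Suc n) c0))"
  proof (intro landau_o.big_mono eventually_mono[OF eventually_gt_at_top[of 0]])
    fix c0 :: real assume "c0 > 0"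
    from fourier_residual_bound[OF assms(1-3) this assms(4)[OF this], of n]
    have "?R c0 \<le> \<kappa> / \<Delta>t / c0 * (?D n c0 + ?D (Suc n) c0)"
      by (simp add: mult.commute)
    then show "norm (?R c0) \<le> norm (\<kappa> / \<Delta>t / c0 * (?D n c0 + ?D (Suc n) c0))"
      using nonneg[of "\<lambda>p. (T c0 (Suc n) p - T c0 n p) / \<Delta>t - \<kappa> * laplace M (half (T c0) n) p"]
      by (simp only: real_norm_def abs_of_nonneg)
  qed
  ultimately have "?R \<in> O[at_top](\<lambda>x. x powr (- (1 + s)))"
    using landau_o.big_trans by blast
  \<comment> \<open>The target order is the finite value \<open>1 + s\<close> also for infinite
    \<open>m\<close>, so the finite branch of the definition applies.\<close>
  then show "decays_with_order ?R (min 2 (1 + m))"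
    unfolding s(3) decays_with_order_def by simp
qed

end
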